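(* Let $P(X),Q(X)\in\mathbb{Q}[X]$ be relatively prime polynomials, and assume that $Q(X)$ has a simple rational root. Then $P(X)-\bar t\,Q(X)$ is irreducible over $\mathbb{Q}$ for all but finitely many $\bar t\in\mathbb{Z}$. *)

theory Defs
  imports "HOL-Computational_Algebra.Computational_Algebra"
begin

end

(* Move the simple root of Q to 0 and clear denominators, so that P and Q have integer
   coefficients, Q(0) = 0, Q'(0) \<noteq> 0 and P(0) \<noteq> 0. Let F = P - t Q. For large t the linear
   coefficient of F is comparable to its largest coefficient, so some disc of radius \<delta> > 0 around
   0, independent of t, contains at most one complex root of F (with multiplicity). If F = g h over
   the integers (Gauss), one of the factors therefore has all its roots outside this disc. Its
   constant coefficient divides F(0) = P(0), so all its coefficients are bounded independently of t
   and only finitely many such factors occur. The same factor cannot occur for two values of t,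
   since it would then divide both P and Q. *)
theory Submission
  imports Defs
begin

section \<open>Integer polynomials over larger rings, and Gauss's lemma\<close>

lemma map_poly_of_int_mult:
  "map_poly (of_int :: int \<Rightarrow> 'a::{comm_ring_1,ring_char_0}) (p * q) = map_poly of_int p * map_poly of_int q"
  by (intro poly_eqI) (simp add: coeff_map_poly coeff_mult)

lemma map_poly_of_int_diff:
  "map_poly (of_int :: int \<Rightarrow> 'a::{comm_ring_1,ring_char_0}) (p - q) = map_poly of_int p - map_poly of_int q"
  by (intro poly_eqI) (simp add: coeff_map_poly)

lemma map_poly_of_int_smult:
  "map_poly (of_int :: int \<Rightarrow> 'a::{comm_ring_1,ring_char_0}) (smult c p) = smult (of_int c) (map_poly of_int p)"
  by (intro poly_eqI) (simp add: coeff_map_poly)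

lemma degree_map_poly_of_int [simp]:
  "degree (map_poly (of_int :: int \<Rightarrow> 'a::{comm_ring_1,ring_char_0}) p) = degree p"
  by (rule degree_map_poly) simp

lemma map_poly_of_int_eq_iff:
  "map_poly (of_int :: int \<Rightarrow> 'a::{comm_ring_1,ring_char_0}) p = map_poly of_int q \<longleftrightarrow> p = q"
  by (auto simp: poly_eq_iff coeff_map_poly)

lemma clear_denominators:
  fixes p :: "rat poly"
  obtains k :: int and P :: "int poly" where "k > 0" "smult (of_int k) p = map_poly of_int P"
proof -
  have "\<exists>k>0. \<exists>P. smult (of_int k) p = map_poly of_int P"
  proof (induction p)
    case 0
    show ?case by (intro exI[of _ 1] conjI exI[of _ 0]) auto
  next
    case (pCons c r)
    then obtain k P where k: "k > 0" "smult (of_int k) r = map_poly of_int P" by blast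
    obtain a b where ab: "quotient_of c = (a, b)" by force
    have b: "b > 0" and c: "c = of_int a / of_int b"
      using ab quotient_of_denom_pos quotient_of_div by blast+
    have "smult (of_int (b * k)) (pCons c r) = pCons (of_int (a * k)) (smult (of_int b) (smult (of_int k) r))"
      using b c by simp
    also have "\<dots> = map_poly of_int (pCons (a * k) (smult b P))"
      unfolding k(2) by (intro poly_eqI) (simp add: coeff_map_poly coeff_pCons split: nat.split)
    finally show ?case using b k(1) by (metis mult_pos_pos)
  qed
  with that show ?thesis by blast
qed

text \<open>Clearing denominators gives \<open>k * l * f = G * H\<close> over the integers.
  Primitive parts are multiplicative and unaffected by the positive factor \<open>k * l\<close>, so
  \<open>f\<close> is its content times the primitive parts of \<open>G\<close> and
  \<open>H\<close>; the content goes into the first factor. Degrees are recorded so that a proper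
  factorization stays proper.\<close>

lemma Gauss_factorization:
  fixes f :: "int poly" and g h :: "rat poly"
  assumes fgh: "map_poly of_int f = g * h" and f: "f \<noteq> 0"
  obtains G H :: "int poly" where "f = G * H" "degree G = degree g" "degree H = degree h"
proof -
  obtain k G where k: "k > 0" "smult (of_int k) g = map_poly of_int G" by (rule clear_denominators)
  obtain l H where l: "l > 0" "smult (of_int l) h = map_poly of_int H" by (rule clear_denominators)
  have "map_poly (of_int :: int \<Rightarrow> rat) (smult (k * l) f) = smult (of_int k) g * smult (of_int l) h"
    by (simp add: map_poly_of_int_smult fgh mult.commute)
  then have eq: "smult (k * l) f = G * H"
    unfolding k l map_poly_of_int_mult[symmetric] map_poly_of_int_eq_iff .
  have "primitive_part (smult (k * l) f) = primitive_part f"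
    using k(1) l(1) by (simp add: primitive_part_smult unit_factor_int_def)
  then have "primitive_part f = primitive_part G * primitive_part H"
    by (simp add: eq primitive_part_mult)
  then have "f = smult (content f) (primitive_part G) * primitive_part H"
    by (metis content_times_primitive_part mult_smult_left)
  moreover have "degree G = degree g"
    using k by (metis degree_map_poly_of_int degree_smult_eq less_irrefl of_int_eq_0_iff)
  moreover have "degree H = degree h"
    using l by (metis degree_map_poly_of_int degree_smult_eq less_irrefl of_int_eq_0_iff)
  moreover have "degree (smult (content f) (primitive_part G)) = degree G"
    using f by simp
  ultimately show ?thesis using that by (metis degree_primitive_part)
qed

section \<open>Coefficient bounds and the location of complex roots\<close>

lemma finite_bounded_int_polys:
  "finite {h :: int poly. degree h \<le> n \<and> (\<forall>i. \<bar>coeff h i\<bar> \<le> M)}"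
proof (rule finite_subset)
  show "finite (Poly ` {xs. set xs \<subseteq> {-M..M} \<and> length xs \<le> Suc n})"
    by (intro finite_imageI finite_lists_length_le) auto
  show "{h. degree h \<le> n \<and> (\<forall>i. \<bar>coeff h i\<bar> \<le> M)} \<subseteq>
    Poly ` {xs. set xs \<subseteq> {-M..M} \<and> length xs \<le> Suc n}"
  proof
    fix h assume h: "h \<in> {h. degree h \<le> n \<and> (\<forall>i. \<bar>coeff h i\<bar> \<le> M)}"
    have "set (coeffs h) \<subseteq> {-M..M}"
    proof
      fix c assume "c \<in> set (coeffs h)"
      then obtain i where "c = coeff h i" by (auto simp: coeffs_def split: if_splits)
      moreover have "\<bar>coeff h i\<bar> \<le> M" using h by blast
      ultimately show "c \<in> {-M..M}" by auto
    qed
    moreover have "length (coeffs h) \<le> Suc n"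
      using h by (cases "h = 0") (auto simp: length_coeffs_degree)
    ultimately show "h \<in> Poly ` {xs. set xs \<subseteq> {-M..M} \<and> length xs \<le> Suc n}"
      by (intro image_eqI[of _ _ "coeffs h"]) auto
  qed
qed

text \<open>Relative to the constant coefficient, the \<open>i\<close>-th coefficient is up to sign
  the \<open>i\<close>-th elementary symmetric function of the reciprocals of the roots, each of
  modulus at most \<open>1 / \<delta>\<close>. The induction splits off one linear factor at a time
  and recombines the binomials by Pascal's rule.\<close>

lemma coeff_bound_if_roots_away_from_0:
  fixes h :: "complex poly"
  assumes "\<delta> > 0" "\<And>z. poly h z = 0 \<Longrightarrow> \<delta> \<le> cmod z"
  shows "cmod (coeff h i) \<le> cmod (coeff h 0) * (degree h choose i) / \<delta> ^ i"
  using assms(2)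
proof (induction "degree h" arbitrary: h i)
  case 0
  then obtain c where "h = [:c:]" by (metis degree_eq_zeroE)
  then show ?case by (cases i) auto
next
  case (Suc n)
  then have "\<not> constant (poly h)" by (simp add: constant_degree)
  then obtain z where z: "poly h z = 0" using fundamental_theorem_of_algebra by blast
  then obtain s where s: "h = [:-z, 1:] * s" by (metis dvdE poly_eq_0_iff_dvd)
  have zd: "\<delta> \<le> cmod z" using Suc z by blast
  then have z0: "cmod z > 0" using assms(1) by linarith
  have s0: "s \<noteq> 0" using Suc.hyps(2) s by auto
  have deg: "degree s = n" using Suc.hyps(2) s0 unfolding s by (subst (asm) degree_mult_eq) auto
  have IH: "cmod (coeff s j) \<le> cmod (coeff s 0) * (n choose j) / \<delta> ^ j" for j
    using Suc.hyps(1)[of s j] deg Suc.prems s by auto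
  have h0: "cmod (coeff h 0) = cmod z * cmod (coeff s 0)"
    by (simp add: s norm_mult)
  show ?case
  proof (cases i)
    case 0
    then show ?thesis by simp
  next
    case (Suc j)
    have "cmod (coeff h i) = cmod (coeff s j - z * coeff s i)"
      by (simp add: s Suc)
    also have "\<dots> \<le> cmod (coeff s j) + cmod z * cmod (coeff s i)"
      by (metis norm_mult norm_triangle_ineq4)
    also have "cmod (coeff s j) \<le> cmod (coeff h 0) * (n choose j) / \<delta> ^ i"
    proof -
      have "cmod (coeff s j) \<le> cmod (coeff s 0) * (n choose j) / \<delta> ^ j" by (rule IH)
      \<comment> \<open>Raising the exponent from \<open>j\<close> to \<open>i = j + 1\<close>
        produces a factor \<open>\<delta>\<close>; replacing it by the larger \<open>cmod z\<close>
        turns the constant coefficient of \<open>s\<close> into that of \<open>h\<close>.\<close>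
      also have "\<dots> = \<delta> * cmod (coeff s 0) * (n choose j) / \<delta> ^ i"
        using assms(1) by (simp add: Suc)
      also have "\<dots> \<le> cmod (coeff h 0) * (n choose j) / \<delta> ^ i"
        unfolding h0 using zd assms(1) by (intro divide_right_mono mult_right_mono) auto
      finally show ?thesis .
    qed
    also have "cmod z * cmod (coeff s i) \<le> cmod z * (cmod (coeff s 0) * (n choose i) / \<delta> ^ i)"
      by (intro mult_left_mono IH) auto
    finally have "cmod (coeff h i) \<le>
      cmod (coeff h 0) * (n choose j) / \<delta> ^ i + cmod (coeff h 0) * (n choose i) / \<delta> ^ i"
      by (simp add: h0)
    also have "\<dots> = cmod (coeff h 0) * (Suc n choose i) / \<delta> ^ i"
      by (simp add: Suc add_divide_distrib algebra_simps)
    finally show ?thesis using Suc.hyps(2) by simp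
  qed
qed

text \<open>Dividing by \<open>X - x\<close> with \<open>|x| \<le> 1\<close> leaves a quotient
  \<open>s\<close> whose coefficients are at most the coefficient sum \<open>B\<close> of
  \<open>F\<close>. Since \<open>s\<close> still vanishes at the small point \<open>z\<close>, its
  constant coefficient is at most \<open>\<delta> * n * B\<close>; the term
  \<open>x * coeff s 1\<close> adds at most \<open>\<delta> * B\<close>, whence the factor
  \<open>n + 1\<close>.\<close>

lemma linear_coeff_bound_if_two_small_roots:
  fixes F :: "complex poly"
  assumes F: "F = [:-x, 1:] * [:-z, 1:] * r"
    and x: "cmod x \<le> \<delta>" and z: "cmod z \<le> \<delta>" and \<delta>: "\<delta> \<le> 1" and n: "degree F \<le> n"
  shows "cmod (coeff F 1) \<le> \<delta> * (real n + 1) * (\<Sum>j\<le>n. cmod (coeff F j))"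
proof (cases "r = 0")
  case True
  have "\<delta> \<ge> 0" using x norm_ge_zero order_trans by blast
  then show ?thesis using True F by simp
next
  case False
  define s where "s = [:-z, 1:] * r"
  define B where "B = (\<Sum>j\<le>n. cmod (coeff F j))"
  have Fs: "F = [:-x, 1:] * s" by (simp only: F s_def mult.assoc)
  have s0: "s \<noteq> 0" using False unfolding s_def mult_eq_0_iff by simp
  have "degree F = Suc (degree s)" unfolding Fs using s0 by (subst degree_mult_eq) simp_all
  then have degs: "degree s < n" using n by simp
  have sz: "poly s z = 0" by (simp add: s_def)
  have rec: "coeff F (Suc i) = coeff s i - x * coeff s (Suc i)" for i
    by (simp add: Fs)
  \<comment> \<open>Synthetic division from the top: the recursion is solved downwards from
    \<open>coeff s n = 0\<close>, and \<open>|x| \<le> 1\<close> keeps earlier terms from being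
    amplified.\<close>
  have tail: "cmod (coeff s i) \<le> (\<Sum>j\<in>{i<..n}. cmod (coeff F j))" if "i \<le> n" for i
    using that
  proof (induction rule: inc_induct)
    case base
    then show ?case using degs by (simp add: coeff_eq_0)
  next
    case (step m)
    have ivl: "{m<..n} = insert (Suc m) {Suc m<..n}" using step.hyps by auto
    have "coeff s m = coeff F (Suc m) + x * coeff s (Suc m)" by (simp add: rec)
    then have "cmod (coeff s m) \<le> cmod (coeff F (Suc m)) + cmod x * cmod (coeff s (Suc m))"
      by (metis norm_mult norm_triangle_ineq)
    also have "cmod x * cmod (coeff s (Suc m)) \<le> 1 * (\<Sum>j\<in>{Suc m<..n}. cmod (coeff F j))"
      using x \<delta> step.IH by (intro mult_mono) auto
    finally show ?case
      using step.hyps by (simp add: ivl)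
  qed
  have sB: "cmod (coeff s i) \<le> B" for i
  proof (cases "i \<le> n")
    case True
    have "(\<Sum>j\<in>{i<..n}. cmod (coeff F j)) \<le> B" unfolding B_def by (rule sum_mono2) auto
    then show ?thesis using tail[OF True] by linarith
  next
    case False
    then show ?thesis using degs by (simp add: coeff_eq_0 B_def sum_nonneg)
  qed
  have \<delta>0: "\<delta> \<ge> 0" using x norm_ge_zero order_trans by blast
  have B0: "B \<ge> 0" by (simp add: B_def sum_nonneg)
  obtain c u where su: "s = pCons c u" by (metis pCons_cases)
  have uB: "cmod (poly u z) \<le> real n * B"
  proof -
    have "cmod (poly u z) \<le> (\<Sum>i\<le>degree u. cmod (coeff u i * z ^ i))"
      by (simp add: poly_altdef norm_sum)
    also have "\<dots> \<le> (\<Sum>i\<le>degree u. B)"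
    proof (rule sum_mono)
      fix i
      have "cmod (coeff u i) \<le> B" using sB[of "Suc i"] by (simp add: su)
      moreover have "cmod z ^ i \<le> 1" using z \<delta> by (intro power_le_one) auto
      ultimately have "cmod (coeff u i) * cmod z ^ i \<le> B * 1" using B0 by (intro mult_mono) auto
      then show "cmod (coeff u i * z ^ i) \<le> B" by (simp add: norm_mult norm_power)
    qed
    also have "\<dots> = real (Suc (degree u)) * B" by simp
    also have "\<dots> \<le> real n * B"
      using degs B0 by (intro mult_right_mono) (auto simp: su split: if_splits)
    finally show ?thesis .
  qed
  have "c = - (z * poly u z)" using sz by (simp add: su eq_neg_iff_add_eq_0)
  then have "cmod c = cmod z * cmod (poly u z)" by (simp add: norm_mult)
  also have "\<dots> \<le> \<delta> * (real n * B)" using z uB \<delta>0 by (intro mult_mono) auto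
  finally have c: "cmod c \<le> \<delta> * (real n * B)" .
  have "coeff F 1 = c - x * coeff s 1" using rec[of 0] by (simp add: su)
  then have "cmod (coeff F 1) \<le> cmod c + cmod x * cmod (coeff s 1)"
    by (metis norm_mult norm_triangle_ineq4)
  also have "cmod x * cmod (coeff s 1) \<le> \<delta> * B"
    using x sB \<delta>0 by (intro mult_mono) auto
  finally show ?thesis using c unfolding B_def[symmetric] by (simp add: algebra_simps)
qed

text \<open>A small root of \<open>g\<close> and a small root of \<open>h\<close>, possibly equal,
  would be two small roots of the product counted with multiplicity, contradicting the preceding
  bound.\<close>

lemma one_factor_without_small_roots:
  fixes g h :: "complex poly"
  assumes "\<delta> \<le> 1" "degree (g * h) \<le> n"
    and big: "\<delta> * (real n + 1) * (\<Sum>j\<le>n. cmod (coeff (g * h) j)) < cmod (coeff (g * h) 1)"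
  shows "(\<forall>z. poly g z = 0 \<longrightarrow> \<delta> \<le> cmod z) \<or> (\<forall>z. poly h z = 0 \<longrightarrow> \<delta> \<le> cmod z)"
proof (rule ccontr)
  assume "\<not> ?thesis"
  then obtain x z where xz: "poly g x = 0" "cmod x \<le> \<delta>" "poly h z = 0" "cmod z \<le> \<delta>"
    by force
  then obtain g' h' where "g = [:-x, 1:] * g'" "h = [:-z, 1:] * h'"
    by (metis dvdE poly_eq_0_iff_dvd)
  then have "g * h = [:-x, 1:] * [:-z, 1:] * (g' * h')" by (simp only: mult_ac)
  from linear_coeff_bound_if_two_small_roots[OF this xz(2,4) assms(1,2)] big show False by linarith
qed

section \<open>Integer factorizations in the family \<open>p - t q\<close>\<close>

text \<open>The uniformity matters: \<open>M\<close> is chosen before \<open>t\<close>,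
  \<open>g\<close> and \<open>h\<close>. It is available because the radius \<open>\<delta>\<close>
  depends only on \<open>p\<close> and \<open>q\<close>, and because \<open>coeff q 0 = 0\<close>
  makes the constant coefficient of \<open>p - t q\<close> independent of \<open>t\<close>.\<close>

lemma proper_divisor_with_bounded_coeffs:
  fixes p q :: "int poly"
  assumes q0: "coeff q 0 = 0" and q1: "coeff q 1 \<noteq> 0" and p0: "coeff p 0 \<noteq> 0"
  obtains M where "\<And>t g h. \<lbrakk>\<bar>t\<bar> > 2 * \<bar>coeff p 1\<bar>; p - smult t q = g * h; degree g > 0; degree h > 0\<rbrakk>
    \<Longrightarrow> \<exists>d. degree d > 0 \<and> degree d \<le> max (degree p) (degree q) \<and> (\<forall>i. \<bar>coeff d i\<bar> \<le> M) \<and>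
          d dvd p - smult t q"
proof -
  define n where "n = max (degree p) (degree q)"
  define K where "K = (\<Sum>j\<le>n. real_of_int (\<bar>coeff p j\<bar> + \<bar>coeff q j\<bar>))"
  \<comment> \<open>The coefficients of \<open>p - t q\<close> have absolute sum at most
    \<open>|t| * K\<close>. This radius makes the two-small-roots bound equal to
    \<open>|t| / 2\<close>, which the linear coefficient exceeds for large \<open>t\<close>.\<close>
  define \<delta> where "\<delta> = 1 / (2 * (real n + 1) * K)"
  \<comment> \<open>Obtained from the root bound with constant coefficient at most
    \<open>|coeff p 0|\<close>, binomials at most \<open>2 ^ n\<close>, and
    \<open>\<delta> ^ i \<ge> \<delta> ^ n\<close> because \<open>\<delta> \<le> 1\<close>.\<close>
  define M where "M = \<bar>real_of_int (coeff p 0)\<bar> * 2 ^ n / \<delta> ^ n"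
  have "1 \<le> degree q" using q1 by (metis le_degree)
  then have "1 \<le> n" by (simp add: n_def)
  then have "real_of_int (\<bar>coeff p 1\<bar> + \<bar>coeff q 1\<bar>) \<le> K"
    unfolding K_def by (intro member_le_sum) auto
  moreover have "1 \<le> real_of_int (\<bar>coeff p 1\<bar> + \<bar>coeff q 1\<bar>)" using q1 by linarith
  ultimately have K: "K \<ge> 1" by linarith
  have "1 * 1 \<le> (2 * (real n + 1)) * K" using K by (intro mult_mono) auto
  then have \<delta>: "\<delta> > 0" "\<delta> \<le> 1" using K by (auto simp: \<delta>_def divide_simps)
  have \<delta>K: "\<delta> * (real n + 1) * K = 1 / 2"
  proof -
    have "2 * (real n + 1) * K \<noteq> 0" using K by simp
    then show ?thesis by (simp add: \<delta>_def divide_simps)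
  qed
  have bound: "\<bar>coeff d i\<bar> \<le> \<lceil>M\<rceil>"
    if d: "degree d \<le> n" "\<And>z. poly (map_poly of_int d :: complex poly) z = 0 \<Longrightarrow> \<delta> \<le> cmod z"
      "coeff d 0 dvd coeff p 0" for d :: "int poly" and i
  proof -
    have d0: "\<bar>real_of_int (coeff d 0)\<bar> \<le> \<bar>real_of_int (coeff p 0)\<bar>"
      using dvd_imp_le_int[OF p0 d(3)] by (metis of_int_abs of_int_le_iff)
    have "\<bar>real_of_int (coeff d i)\<bar> \<le> \<bar>real_of_int (coeff d 0)\<bar> * (degree d choose i) / \<delta> ^ i"
      using coeff_bound_if_roots_away_from_0[where h = "map_poly of_int d" and i = i, OF \<delta>(1) d(2)] by (simp add: coeff_map_poly)
    also have "\<dots> \<le> M"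
    proof (cases "i \<le> degree d")
      case True
      have "real (degree d choose i) \<le> 2 ^ n"
      proof -
        have "(degree d choose i) \<le> 2 ^ degree d" by (rule binomial_le_pow2)
        also have "\<dots> \<le> 2 ^ n" using d(1) by (intro power_increasing) auto
        finally show ?thesis by (metis of_nat_le_iff of_nat_numeral of_nat_power)
      qed
      moreover have "\<delta> ^ n \<le> \<delta> ^ i" using True d(1) \<delta> by (intro power_decreasing) auto
      ultimately show ?thesis unfolding M_def
        using d0 \<delta>(1) by (intro frac_le mult_mono) auto
    next
      case False
      then show ?thesis using \<delta>(1) by (simp add: M_def binomial_eq_0)
    qed
    finally show ?thesis by linarith
  qed
  show ?thesis
  proof (rule that[of "\<lceil>M\<rceil>"])
    fix t g h
    assume t: "\<bar>t\<bar> > 2 * \<bar>coeff p 1\<bar>" and gh: "p - smult t q = g * h"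
      and g: "degree g > 0" and h: "degree h > 0"
    have "degree (g * h) \<le> n" unfolding gh[symmetric]
      by (intro degree_diff_le) (auto simp: n_def intro: order_trans[OF degree_smult_le])
    moreover have "degree (g * h) = degree g + degree h" using g h by (intro degree_mult_eq) auto
    ultimately have deg: "degree (g * h) \<le> n" "degree g \<le> n" "degree h \<le> n" by auto
    let ?c = "map_poly of_int :: int poly \<Rightarrow> complex poly"
    have coeffF: "cmod (coeff (?c g * ?c h) j) = \<bar>real_of_int (coeff p j - t * coeff q j)\<bar>" for j
      by (simp add: map_poly_of_int_mult[symmetric] gh[symmetric] coeff_map_poly flip: of_int_diff of_int_mult)
    have "(\<Sum>j\<le>n. cmod (coeff (?c g * ?c h) j)) \<le> (\<Sum>j\<le>n. \<bar>t\<bar> * (real_of_int (\<bar>coeff p j\<bar> + \<bar>coeff q j\<bar>)))"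
    proof (rule sum_mono)
      fix j
      have "\<bar>coeff p j - t * coeff q j\<bar> \<le> \<bar>coeff p j\<bar> + \<bar>t\<bar> * \<bar>coeff q j\<bar>"
        by (metis abs_mult abs_triangle_ineq4)
      \<comment> \<open>The threshold on \<open>t\<close> also forces
        \<open>|t| \<ge> 1\<close>.\<close>
      also have "\<bar>coeff p j\<bar> \<le> \<bar>t\<bar> * \<bar>coeff p j\<bar>"
        using mult_right_mono[of 1 "\<bar>t\<bar>" "\<bar>coeff p j\<bar>"] t by simp
      finally have "\<bar>coeff p j - t * coeff q j\<bar> \<le> \<bar>t\<bar> * (\<bar>coeff p j\<bar> + \<bar>coeff q j\<bar>)"
        by (simp add: algebra_simps)
      then show "cmod (coeff (?c g * ?c h) j) \<le> \<bar>t\<bar> * (real_of_int (\<bar>coeff p j\<bar> + \<bar>coeff q j\<bar>))"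
        unfolding coeffF by (metis of_int_abs of_int_le_iff of_int_mult)
    qed
    also have "\<dots> = \<bar>t\<bar> * K" by (simp add: K_def sum_distrib_left)
    finally have "\<delta> * (real n + 1) * (\<Sum>j\<le>n. cmod (coeff (?c g * ?c h) j)) \<le> \<delta> * (real n + 1) * (\<bar>t\<bar> * K)"
      using \<delta>(1) by (intro mult_left_mono) auto
    also have "\<dots> = \<bar>t\<bar> / 2" using \<delta>K by (simp add: mult_ac)
    also have "\<dots> < cmod (coeff (?c g * ?c h) 1)"
    proof -
      \<comment> \<open>As a nonzero integer, \<open>coeff q 1\<close> has absolute value at least
        1, while \<open>|coeff p 1| < |t| / 2\<close>; the difference therefore stays above
        \<open>|t| / 2\<close>.\<close>
      have "1 * \<bar>t\<bar> \<le> \<bar>coeff q 1\<bar> * \<bar>t\<bar>" using q1 by (intro mult_right_mono) auto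
      then have "\<bar>t\<bar> \<le> \<bar>t * coeff q 1\<bar>" by (simp add: abs_mult mult.commute)
      then have "\<bar>t\<bar> < 2 * \<bar>coeff p 1 - t * coeff q 1\<bar>"
        using t abs_triangle_ineq2[of "t * coeff q 1" "coeff p 1"] abs_minus_commute[of "coeff p 1"] by smt
      then have "real_of_int \<bar>t\<bar> < real_of_int (2 * \<bar>coeff p 1 - t * coeff q 1\<bar>)"
        by (simp only: of_int_less_iff)
      then show ?thesis unfolding coeffF by simp
    qed
    finally have "(\<forall>z. poly (?c g) z = 0 \<longrightarrow> \<delta> \<le> cmod z) \<or> (\<forall>z. poly (?c h) z = 0 \<longrightarrow> \<delta> \<le> cmod z)"
      using deg by (intro one_factor_without_small_roots[of \<delta> _ _ n] \<delta>)
        (auto simp: map_poly_of_int_mult[symmetric])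
    moreover have "coeff p 0 = coeff g 0 * coeff h 0"
      using arg_cong[OF gh, of "\<lambda>f. coeff f 0"] q0 by (simp add: coeff_mult_0)
    then have "coeff g 0 dvd coeff p 0" "coeff h 0 dvd coeff p 0" by simp_all
    ultimately have "(\<forall>i. \<bar>coeff g i\<bar> \<le> \<lceil>M\<rceil>) \<or> (\<forall>i. \<bar>coeff h i\<bar> \<le> \<lceil>M\<rceil>)"
      using bound deg by blast
    then show "\<exists>d. degree d > 0 \<and> degree d \<le> max (degree p) (degree q) \<and>
        (\<forall>i. \<bar>coeff d i\<bar> \<le> \<lceil>M\<rceil>) \<and> d dvd p - smult t q"
      unfolding gh n_def[symmetric] using g h deg by (metis dvd_triv_left dvd_triv_right)
  qed
qed

text \<open>Small \<open>t\<close> lie in a finite interval. Each remaining \<open>t\<close> is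
  charged to a nonconstant divisor from a finite set, and coprimality lets each such divisor serve
  at most one \<open>t\<close>.\<close>

lemma finite_proper_factorizations:
  fixes p q :: "int poly"
  assumes q0: "coeff q 0 = 0" and q1: "coeff q 1 \<noteq> 0"
    and coprime: "coprime (map_poly of_int p :: rat poly) (map_poly of_int q)"
  shows "finite {t. \<exists>g h. p - smult t q = g * h \<and> degree g > 0 \<and> degree h > 0}"
proof -
  let ?r = "map_poly of_int :: int poly \<Rightarrow> rat poly"
  \<comment> \<open>Over the integers a common divisor may be a nonunit constant, so coprimality
    over the rationals yields only degree 0. The scalar \<open>c\<close> allows for the factor
    \<open>t - u\<close> that appears on eliminating \<open>p\<close> or \<open>q\<close>
    below.\<close>
  have common: "degree d = 0" if "d dvd smult c p" "d dvd smult c q" "c \<noteq> 0" for c d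
  proof -
    have "?r d dvd ?r (smult c p)" "?r d dvd ?r (smult c q)"
      using that by (auto simp: dvd_def map_poly_of_int_mult)
    then have "?r d dvd ?r p" "?r d dvd ?r q"
      using that(3) by (auto simp: map_poly_of_int_smult dvd_smult_iff)
    then have "is_unit (?r d)" by (rule coprime_common_divisor[OF coprime])
    moreover from this have "?r d \<noteq> 0" by auto
    ultimately have "degree (?r d) = 0" by (simp add: is_unit_iff_degree)
    then show ?thesis by simp
  qed
  have p0: "coeff p 0 \<noteq> 0"
  proof
    assume "coeff p 0 = 0"
    then have "[:0, 1:] dvd p" "[:0, 1:] dvd q"
      using q0 poly_eq_0_iff_dvd[of _ 0] by (auto simp: poly_0_coeff_0)
    then show False using common[of "[:0, 1:]" 1] by simp
  qed
  obtain M where M: "\<And>t g h. \<lbrakk>\<bar>t\<bar> > 2 * \<bar>coeff p 1\<bar>; p - smult t q = g * h; degree g > 0; degree h > 0\<rbrakk>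
    \<Longrightarrow> \<exists>d. degree d > 0 \<and> degree d \<le> max (degree p) (degree q) \<and> (\<forall>i. \<bar>coeff d i\<bar> \<le> M) \<and>
          d dvd p - smult t q"
    using proper_divisor_with_bounded_coeffs[OF q0 q1 p0] by blast
  define S where "S = {d :: int poly. degree d \<le> max (degree p) (degree q) \<and> (\<forall>i. \<bar>coeff d i\<bar> \<le> M)}"
  have "finite {t. d dvd p - smult t q}" if d: "degree d > 0" for d
  proof -
    have "t = u" if tu: "d dvd p - smult t q" "d dvd p - smult u q" for t u
    proof (rule ccontr)
      assume "t \<noteq> u"
      \<comment> \<open>This combination eliminates \<open>p\<close> and leaves
        \<open>(t - u) q\<close>; the next one eliminates \<open>q\<close> and leaves
        \<open>(t - u) p\<close>.\<close>
      have "d dvd (p - smult u q) - (p - smult t q)" using tu by (rule dvd_diff[rotated])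
      moreover have "d dvd smult t (p - smult u q) - smult u (p - smult t q)"
        by (rule dvd_diff) (rule dvd_smult, rule tu)+
      ultimately have "d dvd smult (t - u) q" "d dvd smult (t - u) p"
        by (auto simp: smult_diff_left smult_diff_right mult.commute)
      then show False using common[of d "t - u"] \<open>t \<noteq> u\<close> d by auto
    qed
    then have "{t. d dvd p - smult t q} \<subseteq> {THE t. d dvd p - smult t q}"
      by (auto intro!: the_equality[symmetric])
    then show ?thesis by (rule finite_subset) simp
  qed
  moreover have "finite S" unfolding S_def by (rule finite_bounded_int_polys)
  ultimately have "finite (\<Union>d\<in>{d\<in>S. degree d > 0}. {t. d dvd p - smult t q})" by auto
  moreover have "{t. \<exists>g h. p - smult t q = g * h \<and> degree g > 0 \<and> degree h > 0} \<subseteq>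
      {-(2 * \<bar>coeff p 1\<bar>)..2 * \<bar>coeff p 1\<bar>} \<union> (\<Union>d\<in>{d\<in>S. degree d > 0}. {t. d dvd p - smult t q})"
  proof clarify
    fix t g h assume gh: "p - smult t q = g * h" "degree g > 0" "degree h > 0"
      and "t \<notin> (\<Union>d\<in>{d\<in>S. degree d > 0}. {t. d dvd p - smult t q})"
    then have "\<not> \<bar>t\<bar> > 2 * \<bar>coeff p 1\<bar>" using M[OF _ gh] unfolding S_def by blast
    then show "t \<in> {-(2 * \<bar>coeff p 1\<bar>)..2 * \<bar>coeff p 1\<bar>}" by auto
  qed
  ultimately show ?thesis by (meson finite_Un finite_atLeastAtMost_int finite_subset)
qed

section \<open>Translation of the root to 0 and descent to integer polynomials\<close>

text \<open>Translation by \<open>-a\<close> inverts translation by \<open>a\<close> and respects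
  products, so it carries common divisors back to common divisors of \<open>P\<close> and
  \<open>Q\<close> without changing their degree.\<close>

lemma coprime_pcompose_translation:
  fixes P Q :: "'a::field poly"
  assumes "coprime P Q"
  shows "coprime (pcompose P [:a, 1:]) (pcompose Q [:a, 1:])"
proof (rule coprimeI)
  have shift_back: "pcompose d [:-a, 1:] dvd f" if d: "d dvd pcompose f [:a, 1:]" for d f
  proof -
    have "pcompose (pcompose f [:a, 1:]) [:-a, 1:] = f"
      by (simp add: pcompose_assoc[symmetric] pcompose_pCons)
    then show ?thesis using d by (metis dvd_def pcompose_mult)
  qed
  fix d assume "d dvd pcompose P [:a, 1:]" "d dvd pcompose Q [:a, 1:]"
  then have unit: "is_unit (pcompose d [:-a, 1:])"
    using assms by (meson shift_back coprime_common_divisor)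
  then have "pcompose d [:-a, 1:] \<noteq> 0" by auto
  with unit have "d \<noteq> 0" "degree d = 0"
    by (auto simp: is_unit_iff_degree degree_pcompose)
  then show "is_unit d" by (simp add: is_unit_iff_degree)
qed

theorem theorem5p10:
  fixes P Q :: "rat poly"
  assumes "coprime P Q"
    and "Q \<noteq> 0 \<and> (\<exists>a::rat. order a Q = 1)"
  shows "finite {t :: int. \<not> irreducible (P - smult (of_int t) Q)}"
proof -
  obtain a where Q: "Q \<noteq> 0" and a: "order a Q = 1" using assms(2) by blast
  obtain Q1 where Q1: "Q = [:-a, 1:] * Q1" "\<not> [:-a, 1:] dvd Q1"
    using order_decomp[OF Q, of a] a by auto
  have Q1a: "poly Q1 a \<noteq> 0" using Q1(2) by (simp add: poly_eq_0_iff_dvd)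
  define sh where "sh f = pcompose f [:a, 1:]" for f :: "rat poly"
  have sh_deg [simp]: "degree (sh f) = degree f" for f by (simp add: sh_def degree_pcompose)
  have shQ: "sh Q = [:0, 1:] * sh Q1" unfolding sh_def Q1(1) pcompose_mult by (simp add: pcompose_pCons)
  have sh0: "coeff (sh Q1) 0 \<noteq> 0" using Q1a by (simp add: sh_def poly_0_coeff_0[symmetric] poly_pcompose)
  obtain k p' where k: "k > 0" "smult (of_int k) (sh P) = map_poly of_int p'" by (rule clear_denominators)
  obtain l q' where l: "l > 0" "smult (of_int l) (sh Q) = map_poly of_int q'" by (rule clear_denominators)
  \<comment> \<open>Cross-multiplying gives both polynomials the same scalar \<open>k * l\<close>,
    so that \<open>p - t q\<close> is a multiple of the translated \<open>P - t Q\<close> for the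
    same \<open>t\<close>.\<close>
  define p where "p = smult l p'"
  define q where "q = smult k q'"
  let ?r = "map_poly of_int :: int poly \<Rightarrow> rat poly"
  have rp: "?r p = smult (of_int (k * l)) (sh P)" and rq: "?r q = smult (of_int (k * l)) (sh Q)"
    by (simp_all add: p_def q_def map_poly_of_int_smult k(2)[symmetric] l(2)[symmetric] mult.commute)
  have kl: "k * l \<noteq> 0" using k(1) l(1) by simp
  have coeff_q: "of_int (coeff q i) = of_int (k * l) * coeff (sh Q) i" for i
    using arg_cong[OF rq, of "\<lambda>f. coeff f i"] by (simp add: coeff_map_poly)
  have "coeff q 0 = 0" using coeff_q[of 0] by (simp add: shQ)
  moreover have "coeff q 1 \<noteq> 0" using coeff_q[of 1] kl sh0 by (auto simp: shQ)
  moreover have "coprime (?r p) (?r q)"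
    using coprime_pcompose_translation[OF assms(1), of a] kl unfolding rp rq sh_def[symmetric]
    by (intro coprimeI) (auto simp: dvd_smult_iff dest: coprime_common_divisor)
  ultimately have fin: "finite {t. \<exists>g h. p - smult t q = g * h \<and> degree g > 0 \<and> degree h > 0}"
    by (rule finite_proper_factorizations)
  define d where "d = degree Q"
  have d0: "d > 0"
    using Q1(2) Q unfolding d_def Q1(1) by (subst degree_mult_eq) auto
  \<comment> \<open>The extra point covers the only value at which the coefficient of
    \<open>P - t Q\<close> in degree \<open>d\<close> can vanish. If the quotient is an integer, the
    floor is that integer; otherwise no \<open>t\<close> is exceptional and the point is
    harmless.\<close>
  have "{t :: int. \<not> irreducible (P - smult (of_int t) Q)} \<subseteq>
    {t. \<exists>g h. p - smult t q = g * h \<and> degree g > 0 \<and> degree h > 0} \<union> {\<lfloor>coeff P d / coeff Q d\<rfloor>}"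
  proof clarify
    fix t :: int
    assume irr: "\<not> irreducible (P - smult (of_int t) Q)" and ne: "t \<noteq> \<lfloor>coeff P d / coeff Q d\<rfloor>"
    define F where "F = P - smult (of_int t) Q"
    have degF: "degree F > 0"
    proof (rule ccontr)
      assume "\<not> degree F > 0"
      then have "coeff F d = 0" using d0 by (simp add: coeff_eq_0)
      then have "of_int t = coeff P d / coeff Q d" using Q by (simp add: F_def d_def field_simps)
      then show False using ne by (metis floor_of_int)
    qed
    then have F0: "F \<noteq> 0" by auto
    have "\<not> is_unit F" using degF by (auto simp: is_unit_iff_degree F0)
    then obtain g h where gh: "F = g * h" "\<not> is_unit g" "\<not> is_unit h"
      using irr F0 unfolding irreducible_def F_def[symmetric] by blast
    then have gh_deg: "degree g > 0" "degree h > 0" using F0 by (auto simp: is_unit_iff_degree)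
    \<comment> \<open>The scalar is absorbed into the first factor, which leaves a product of
      exactly two rational polynomials with the degrees of \<open>g\<close> and \<open>h\<close>, as
      Gauss's lemma requires.\<close>
    have eq: "?r (p - smult t q) = smult (of_int (k * l)) (sh g) * sh h"
    proof -
      have "sh F = sh g * sh h" by (simp add: gh sh_def pcompose_mult)
      moreover have "sh F = sh P - smult (of_int t) (sh Q)"
        by (simp add: F_def sh_def pcompose_diff pcompose_smult)
      ultimately have "sh g * sh h = sh P - smult (of_int t) (sh Q)" by simp
      then show ?thesis unfolding mult_smult_left
        by (simp add: map_poly_of_int_diff map_poly_of_int_smult rp rq smult_diff_right mult_ac)
    qed
    have "degree (?r (p - smult t q)) > 0"
    proof -
      have "sh g \<noteq> 0" "sh h \<noteq> 0" using gh_deg sh_deg by (metis degree_0 less_irrefl)+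
      then show ?thesis unfolding eq using kl gh_deg by (subst degree_mult_eq) auto
    qed
    then have "p - smult t q \<noteq> 0" by auto
    from Gauss_factorization[OF eq this] obtain G H
      where "p - smult t q = G * H" "degree G = degree g" "degree H = degree h"
      using kl by auto
    then show "\<exists>g h. p - smult t q = g * h \<and> degree g > 0 \<and> degree h > 0"
      using gh_deg by metis
  qed
  with fin show ?thesis by (meson finite.emptyI finite.insertI finite_Un finite_subset)
qed

end
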